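(* Let $t_0<T<+\infty$ and let $a,b,c,d$ be real-valued continuous functions on $[t_0,T]$. Assume: (1) $a(t)>0$ almost everywhere on $[t_0,T]$; (2) $\frac{b^2(t)}{a(t)}$ is integrable on $[t_0,T]$; (3) $\displaystyle\int_{t_0}^{T}\Big[c(t)-\frac{b^2(t)}{4a(t)}\Big]dt>0$; (4) $d(t)\ge0$ for all $t\in[t_0,T]$. Then the equation $$y'+a(t)y^3+b(t)y^2+c(t)y+d(t)=0$$ has a nonpositive closed solution on $[t_0,T]$.
   Context: A solution $y(t)$ of the equation, existing on an interval $[t_0,T]$, is called closed on $[t_0,T]$ if $y(t_0)=y(T)$. A solution on an interval is a real-valued differentiable function satisfying the equation at every point of the interval (one-sided derivatives at the endpoints). "Integrable" means Lebesgue integrable. *)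

theory Defs
  imports "HOL-Analysis.Analysis"
begin

(* The derivative is taken within {s..e}, hence one-sided at the two endpoints. *)
definition abel_solution_on ::
  "(real \<Rightarrow> real) \<Rightarrow> (real \<Rightarrow> real) \<Rightarrow> (real \<Rightarrow> real) \<Rightarrow> (real \<Rightarrow> real) \<Rightarrow>
   real \<Rightarrow> real \<Rightarrow> (real \<Rightarrow> real) \<Rightarrow> bool" where
  "abel_solution_on a b c d s e y \<longleftrightarrow>
     (\<forall>t\<in>{s..e}. \<exists>y'. (y has_real_derivative y') (at t within {s..e}) \<and>
        y' + a t * y t ^ 3 + b t * y t ^ 2 + c t * y t + d t = 0)"

definition abel_closed_solution_on ::
  "(real \<Rightarrow> real) \<Rightarrow> (real \<Rightarrow> real) \<Rightarrow> (real \<Rightarrow> real) \<Rightarrow> (real \<Rightarrow> real) \<Rightarrow>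
   real \<Rightarrow> real \<Rightarrow> (real \<Rightarrow> real) \<Rightarrow> bool" where
  "abel_closed_solution_on a b c d s e y \<longleftrightarrow>
     abel_solution_on a b c d s e y \<and> y s = y e"

end

theory Submission
  imports Defs
begin

text \<open>
  Put \<open>z = - y\<close>.  The task becomes to find a closed solution \<open>z \<ge> 0\<close> of \<open>z' = F t z\<close> with
  \<open>F t z = d t - c t * z + b t * z\<^sup>2 - a t * z\<^sup>3\<close>.  Instead of fixing a point of the return map,
  which would need existence, uniqueness and continuous dependence for initial value problems, the
  proof uses the monotone iteration between a lower solution \<open>\<alpha>\<close> and an upper solution \<open>\<beta>\<close> of the
  boundary value problem.  When \<open>K\<close> is so large that \<open>x \<mapsto> F t x + K * x\<close> increases between \<open>\<alpha> t\<close>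
  and \<open>\<beta> t\<close>, write the equation as \<open>z' + K * z = F t z + K * z\<close>.  The linear operator on the left
  has an explicit inverse under the condition \<open>z s = z e\<close> (\<open>periodic_resolvent\<close>), and this inverse
  is order preserving (\<open>periodic_comparison\<close>).  Iterating from \<open>\<alpha>\<close> therefore gives an increasing
  sequence below \<open>\<beta>\<close>; its pointwise limit satisfies the integral equation by dominated
  convergence, and hence the differential equation
  (\<open>closed_solution_between_lower_and_upper\<close>).

  Since \<open>d \<ge> 0\<close>, the constant \<open>0\<close> is a lower solution.  For an upper solution
  (\<open>upper_solution_exists\<close>), completing the square gives \<open>a * z\<^sup>2 - b * z + c \<ge> p\<close> with
  \<open>p = c - b\<^sup>2 / (4 * a)\<close>, so \<open>F t z \<le> d t - p t * z\<close> for \<open>z \<ge> 0\<close>.  If \<open>\<sigma> > 0\<close> is the integral of \<open>p\<close>,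
  \<open>\<eta> = \<sigma> / (e - s)\<close>, and \<open>P\<close> is a primitive of \<open>p\<close>, then \<open>\<beta> t = C * exp (\<eta> * (t - s) - P t)\<close> has
  \<open>\<beta>' = \<eta> * \<beta> - p * \<beta>\<close> and \<open>\<beta> s = \<beta> e\<close>, and \<open>\<eta> * \<beta>\<close> dominates \<open>d\<close> when \<open>C\<close> is large.  As \<open>p\<close> may be
  unbounded, it is replaced by the continuous function \<open>c - b\<^sup>2 / (4 * (a + \<epsilon>))\<close>.  This is at least
  \<open>p\<close> almost everywhere, so it has no smaller integral, and it costs an error \<open>\<epsilon> * \<beta>\<^sup>3\<close>; the error is
  absorbed into half of \<open>\<eta> * \<beta>\<close>, because the bounds on the regularised primitives, and with them
  the bounds on \<open>\<beta>\<close>, do not depend on \<open>\<epsilon>\<close> (\<open>regularised_average\<close>).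
\<close>

section \<open>The linear periodic problem\<close>

text \<open>
  Variation of constants for \<open>u' + K * u = g\<close>; the first summand in the bracket is the initial
  value \<open>u s\<close> that the condition \<open>u s = u e\<close> forces.
\<close>
definition periodic_resolvent :: "real \<Rightarrow> real \<Rightarrow> real \<Rightarrow> (real \<Rightarrow> real) \<Rightarrow> real \<Rightarrow> real" where
  "periodic_resolvent K s e g t =
     exp (- K * (t - s)) *
       (integral {s..e} (\<lambda>r. exp (K * (r - s)) * g r) / (exp (K * (e - s)) - 1) +
        integral {s..t} (\<lambda>r. exp (K * (r - s)) * g r))"

lemma periodic_resolvent_periodic:
  assumes "s < e" "K > 0"
  shows "periodic_resolvent K s e g s = periodic_resolvent K s e g e"
proof -
  define E where "E = exp (K * (e - s))"
  define J where "J = integral {s..e} (\<lambda>r. exp (K * (r - s)) * g r)"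
  have "E > 1"
    using assms by (simp add: E_def)
  have inv_E: "exp (- K * (e - s)) = 1 / E"
    unfolding E_def by (simp add: exp_minus inverse_eq_divide)
  have "periodic_resolvent K s e g e = 1 / E * (J / (E - 1) + J)"
    unfolding periodic_resolvent_def J_def[symmetric] E_def[symmetric] inv_E ..
  moreover have "periodic_resolvent K s e g s = J / (E - 1)"
    by (simp add: periodic_resolvent_def J_def E_def)
  moreover have "1 / E * (J / (E - 1) + J) = J / (E - 1)"
    using \<open>E > 1\<close> by (simp add: field_simps)
  ultimately show ?thesis
    by simp
qed

lemma periodic_resolvent_has_derivative:
  assumes "continuous_on {s..e} g" "t \<in> {s..e}"
  shows "(periodic_resolvent K s e g has_real_derivative g t - K * periodic_resolvent K s e g t)
           (at t within {s..e})"
proof -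
  define h where "h = (\<lambda>r. exp (K * (r - s)) * g r)"
  have "continuous_on {s..e} h"
    unfolding h_def by (intro continuous_intros assms)
  then have "((\<lambda>x. integral {s..x} h) has_real_derivative h t) (at t within {s..e})"
    by (rule integral_has_real_derivative) (use assms in auto)
  then have deriv: "((\<lambda>x. exp (- K * (x - s)) * (C + integral {s..x} h)) has_real_derivative
      exp (- K * (t - s)) * h t - K * (exp (- K * (t - s)) * (C + integral {s..t} h)))
      (at t within {s..e})" for C
    by (auto intro!: derivative_eq_intros simp: algebra_simps)
  have "exp (- K * (t - s)) * h t = g t"
    by (simp add: h_def mult.assoc[symmetric] exp_add[symmetric])
  from deriv[unfolded this] show ?thesis
    unfolding h_def periodic_resolvent_def [abs_def] .
qed

text \<open>
  The difference \<open>w - u\<close>, multiplied by \<open>exp (K * (t - s))\<close>, is nondecreasing.  Over the whole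
  interval this factor grows strictly, so a negative difference at \<open>e\<close> would have come from a still
  more negative one at \<open>s\<close>, against the condition on the end points.  Hence the difference starts
  nonnegative and stays so.
\<close>
lemma periodic_comparison:
  fixes u w u' w' :: "real \<Rightarrow> real"
  assumes "s < e" "K > 0"
    and u: "\<And>t. t \<in> {s..e} \<Longrightarrow> (u has_real_derivative u' t) (at t within {s..e})"
    and w: "\<And>t. t \<in> {s..e} \<Longrightarrow> (w has_real_derivative w' t) (at t within {s..e})"
    and le: "\<And>t. t \<in> {s..e} \<Longrightarrow> u' t + K * u t \<le> w' t + K * w t"
    and ends: "u s - u e \<le> w s - w e"
    and t: "t \<in> {s..e}"
  shows "u t \<le> w t"
proof -
  define m where "m t = exp (K * (t - s)) * (w t - u t)" for t
  have m': "(m has_real_derivative exp (K * (x - s)) * ((w' x + K * w x) - (u' x + K * u x)))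
      (at x within {s..e})" if "x \<in> {s..e}" for x
    unfolding m_def using u[OF that] w[OF that]
    by (auto intro!: derivative_eq_intros simp: algebra_simps)
  have mono: "m x \<le> m y" if "s \<le> x" "x \<le> y" "y \<le> e" for x y
  proof (rule DERIV_nonneg_imp_increasing_open [OF \<open>x \<le> y\<close>])
    fix z assume z: "x < z" "z < y"
    then have "(m has_real_derivative exp (K * (z - s)) * ((w' z + K * w z) - (u' z + K * u z))) (at z)"
      using m'[of z] that at_within_Icc_at[of s z e] by auto
    moreover have "0 \<le> exp (K * (z - s)) * ((w' z + K * w z) - (u' z + K * u z))"
      using le[of z] z that by simp
    ultimately show "\<exists>D. (m has_real_derivative D) (at z) \<and> 0 \<le> D"
      by blast
  next
    have "continuous_on {s..e} m"
      by (rule DERIV_continuous_on) (rule m')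
    then show "continuous_on {x..y} m"
      by (rule continuous_on_subset) (use that in auto)
  qed
  have "w e - u e \<le> w s - u s"
    using ends by simp
  also have "\<dots> \<le> exp (K * (e - s)) * (w e - u e)"
    using mono[of s e] \<open>s < e\<close> by (simp add: m_def)
  finally have "0 \<le> (exp (K * (e - s)) - 1) * (w e - u e)"
    by (simp add: algebra_simps)
  moreover have "exp (K * (e - s)) - 1 > 0"
    using assms(1,2) by simp
  ultimately have "0 \<le> w e - u e"
    by (simp add: zero_le_mult_iff)
  then have "0 \<le> m s"
    using ends by (simp add: m_def)
  also have "\<dots> \<le> m t"
    using mono[of s t] t by simp
  finally show ?thesis
    by (simp add: m_def zero_le_mult_iff)
qed

section \<open>Monotone iteration between a lower and an upper solution\<close>

text \<open>
  One step \<open>\<Phi>\<close> of the iteration solves the linear periodic problem with right-hand side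
  \<open>F t (w t) + K * w t\<close>.  The one-sided Lipschitz condition \<open>slope\<close> makes \<open>\<Phi>\<close> increasing, and the
  differential inequalities for \<open>\<alpha>\<close> and \<open>\<beta>\<close> give, by comparison, \<open>\<alpha> \<le> \<Phi> \<alpha>\<close> and \<open>\<Phi> \<beta> \<le> \<beta>\<close>.
\<close>
theorem closed_solution_between_lower_and_upper:
  fixes F :: "real \<Rightarrow> real \<Rightarrow> real" and \<alpha> \<beta> \<alpha>' \<beta>' :: "real \<Rightarrow> real"
  assumes "s < e" "K > 0"
    and F: "continuous_on ({s..e} \<times> UNIV) (\<lambda>(t, x). F t x)"
    and slope: "\<And>t x y. t \<in> {s..e} \<Longrightarrow> \<alpha> t \<le> x \<Longrightarrow> x \<le> y \<Longrightarrow> y \<le> \<beta> t \<Longrightarrow>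
                  F t x + K * x \<le> F t y + K * y"
    and \<alpha>: "\<And>t. t \<in> {s..e} \<Longrightarrow> (\<alpha> has_real_derivative \<alpha>' t) (at t within {s..e})"
    and \<beta>: "\<And>t. t \<in> {s..e} \<Longrightarrow> (\<beta> has_real_derivative \<beta>' t) (at t within {s..e})"
    and lower: "\<And>t. t \<in> {s..e} \<Longrightarrow> \<alpha>' t \<le> F t (\<alpha> t)" "\<alpha> s \<le> \<alpha> e"
    and upper: "\<And>t. t \<in> {s..e} \<Longrightarrow> F t (\<beta> t) \<le> \<beta>' t" "\<beta> e \<le> \<beta> s"
    and le: "\<And>t. t \<in> {s..e} \<Longrightarrow> \<alpha> t \<le> \<beta> t"
  obtains z where
    "\<And>t. t \<in> {s..e} \<Longrightarrow> (z has_real_derivative F t (z t)) (at t within {s..e})"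
    "z s = z e" "\<And>t. t \<in> {s..e} \<Longrightarrow> \<alpha> t \<le> z t \<and> z t \<le> \<beta> t"
proof -
  define G where "G w t = F t (w t) + K * w t" for w t
  define \<Phi> where "\<Phi> w = periodic_resolvent K s e (G w)" for w
  define adm where "adm w \<longleftrightarrow> continuous_on {s..e} w \<and> (\<forall>t\<in>{s..e}. \<alpha> t \<le> w t \<and> w t \<le> \<beta> t)" for w

  have G_cont: "continuous_on {s..e} (G w)" if "continuous_on {s..e} w" for w
  proof -
    have "continuous_on {s..e} (\<lambda>t. (\<lambda>(t, x). F t x) (t, w t))"
      by (rule continuous_on_compose2[OF F]) (auto intro!: continuous_intros that)
    then show ?thesis
      unfolding G_def using that by (auto intro!: continuous_intros)
  qed
  have \<Phi>_deriv: "(\<Phi> w has_real_derivative G w t - K * \<Phi> w t) (at t within {s..e})"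
    if "continuous_on {s..e} w" "t \<in> {s..e}" for w t
    unfolding \<Phi>_def by (rule periodic_resolvent_has_derivative[OF G_cont]) (use that in auto)
  have \<Phi>_closed: "\<Phi> w s = \<Phi> w e" for w
    unfolding \<Phi>_def by (rule periodic_resolvent_periodic) (use assms in auto)
  have G_mono: "G u t \<le> G w t"
    if "t \<in> {s..e}" "\<alpha> t \<le> u t" "u t \<le> w t" "w t \<le> \<beta> t" for u w t
    using slope[OF that] by (simp add: G_def)
  have \<alpha>_cont: "continuous_on {s..e} \<alpha>" and \<beta>_cont: "continuous_on {s..e} \<beta>"
    by (rule DERIV_continuous_on, erule \<alpha>) (rule DERIV_continuous_on, erule \<beta>)

  have \<Phi>_mono: "\<Phi> u t \<le> \<Phi> w t"
    if "adm u" "adm w" "\<And>t. t \<in> {s..e} \<Longrightarrow> u t \<le> w t" "t \<in> {s..e}" for u w t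
  proof (rule periodic_comparison[OF \<open>s < e\<close> \<open>K > 0\<close> _ _ _ _ \<open>t \<in> {s..e}\<close>])
    show "\<Phi> u s - \<Phi> u e \<le> \<Phi> w s - \<Phi> w e"
      by (simp add: \<Phi>_closed)
  qed (use that in \<open>auto simp: adm_def intro!: \<Phi>_deriv G_mono\<close>)
  have \<Phi>_adm: "adm (\<Phi> w)" if "adm w" for w
    unfolding adm_def
  proof (intro conjI ballI)
    have w: "continuous_on {s..e} w"
      using that by (simp add: adm_def)
    show "continuous_on {s..e} (\<Phi> w)"
      by (rule DERIV_continuous_on) (erule \<Phi>_deriv[OF w])
    fix t assume t: "t \<in> {s..e}"
    show "\<alpha> t \<le> \<Phi> w t"
    proof (rule periodic_comparison[OF \<open>s < e\<close> \<open>K > 0\<close> \<alpha> \<Phi>_deriv[OF w] _ _ t])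
      fix x assume x: "x \<in> {s..e}"
      have "G \<alpha> x \<le> G w x"
        using that x by (auto simp: adm_def intro!: G_mono)
      then show "\<alpha>' x + K * \<alpha> x \<le> G w x - K * \<Phi> w x + K * \<Phi> w x"
        using lower(1)[OF x] by (simp add: G_def)
    qed (use lower(2) in \<open>simp_all add: \<Phi>_closed\<close>)
    show "\<Phi> w t \<le> \<beta> t"
    proof (rule periodic_comparison[OF \<open>s < e\<close> \<open>K > 0\<close> \<Phi>_deriv[OF w] \<beta> _ _ t])
      fix x assume x: "x \<in> {s..e}"
      have "G w x \<le> G \<beta> x"
        using that x by (auto simp: adm_def intro!: G_mono)
      then show "G w x - K * \<Phi> w x + K * \<Phi> w x \<le> \<beta>' x + K * \<beta> x"
        using upper(1)[OF x] by (simp add: G_def)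
    qed (use upper(2) in \<open>simp_all add: \<Phi>_closed\<close>)
  qed

  define v where "v n = (\<Phi> ^^ n) \<alpha>" for n
  have v_Suc: "v (Suc n) = \<Phi> (v n)" for n
    by (simp add: v_def)
  have v_adm: "adm (v n)" for n
  proof (induction n)
    case 0
    show ?case
      using \<alpha>_cont le by (simp add: v_def adm_def)
  qed (simp add: v_Suc \<Phi>_adm)
  have v_step: "v n t \<le> v (Suc n) t" if "t \<in> {s..e}" for n t
    using that
  proof (induction n arbitrary: t)
    case 0
    then show ?case
      using v_adm[of 1] by (simp add: v_def adm_def)
  next
    case (Suc n)
    have "\<Phi> (v n) t \<le> \<Phi> (v (Suc n)) t"
      by (rule \<Phi>_mono[OF v_adm v_adm Suc.IH Suc.prems])
    then show ?case
      by (simp only: v_Suc)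
  qed
  define z where "z t = lim (\<lambda>n. v n t)" for t
  have v_lim: "(\<lambda>n. v n t) \<longlonglongrightarrow> z t" if t: "t \<in> {s..e}" for t
  proof -
    have "incseq (\<lambda>n. v n t)"
      using v_step[OF t] by (rule incseq_SucI)
    moreover have "\<forall>n. v n t \<le> \<beta> t"
      using v_adm t by (simp add: adm_def)
    ultimately obtain l where "(\<lambda>n. v n t) \<longlonglongrightarrow> l"
      by (rule incseq_convergent)
    then show ?thesis
      by (simp add: z_def limI)
  qed
  have z_between: "\<alpha> t \<le> z t \<and> z t \<le> \<beta> t" if t: "t \<in> {s..e}" for t
  proof
    show "\<alpha> t \<le> z t"
      by (rule LIMSEQ_le_const[OF v_lim[OF t]]) (use v_adm t in \<open>simp add: adm_def\<close>)
    show "z t \<le> \<beta> t"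
      by (rule LIMSEQ_le_const2[OF v_lim[OF t]]) (use v_adm t in \<open>simp add: adm_def\<close>)
  qed

  have G_lim: "(\<lambda>n. G (v n) t) \<longlonglongrightarrow> G z t" if t: "t \<in> {s..e}" for t
  proof -
    have "continuous_on UNIV (\<lambda>x. (\<lambda>(t, x). F t x) (t, x))"
      by (rule continuous_on_compose2[OF F]) (use t in \<open>auto intro!: continuous_intros\<close>)
    then have "isCont (F t) (z t)"
      by (simp add: continuous_on_eq_continuous_at)
    then have "(\<lambda>n. F t (v n t)) \<longlonglongrightarrow> F t (z t)"
      using v_lim[OF t] by (rule isCont_tendsto_compose)
    then show ?thesis
      unfolding G_def by (intro tendsto_intros v_lim[OF t])
  qed

  \<comment> \<open>The limit is not yet known to be continuous, so the integral equation is obtained by dominated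
    convergence.  The dominating function comes from the end terms of the chain
    \<open>G \<alpha> \<le> G (v n) \<le> G \<beta>\<close>.\<close>
  define H where "H w r = exp (K * (r - s)) * G w r" for w r
  define B where "B r = exp (K * (r - s)) * (\<bar>G \<alpha> r\<bar> + \<bar>G \<beta> r\<bar>)" for r
  have H_cont: "continuous_on {s..e} (H w)" if "continuous_on {s..e} w" for w
    unfolding H_def by (intro continuous_intros G_cont that)
  have H_lim: "H z integrable_on {s..t} \<and>
      (\<lambda>n. integral {s..t} (H (v n))) \<longlonglongrightarrow> integral {s..t} (H z)" if t: "t \<in> {s..e}" for t
  proof -
    have v_cont: "continuous_on {s..t} (H (v n))" for n
      using H_cont[of "v n"] v_adm[of n] t by (auto simp: adm_def intro: continuous_on_subset)
    have "continuous_on {s..e} B"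
      unfolding B_def by (intro continuous_intros G_cont \<alpha>_cont \<beta>_cont)
    then have B_cont: "continuous_on {s..t} B"
      using t by (auto intro: continuous_on_subset)
    have B_bound: "norm (H (v n) r) \<le> B r" if "r \<in> {s..t}" for n r
    proof -
      have "r \<in> {s..e}"
        using that t by auto
      then have "G \<alpha> r \<le> G (v n) r" "G (v n) r \<le> G \<beta> r"
        using v_adm[of n] by (auto simp: adm_def intro!: G_mono)
      then have "\<bar>G (v n) r\<bar> \<le> \<bar>G \<alpha> r\<bar> + \<bar>G \<beta> r\<bar>"
        by linarith
      then show ?thesis
        by (simp add: H_def B_def abs_mult)
    qed
    have lim: "(\<lambda>n. H (v n) r) \<longlonglongrightarrow> H z r" if "r \<in> {s..t}" for r
      unfolding H_def using that t by (intro tendsto_intros G_lim) auto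
    have ints: "H (v n) integrable_on {s..t}" "B integrable_on {s..t}" for n
      using v_cont B_cont by (auto intro: integrable_continuous_real)
    show ?thesis
      using dominated_convergence[OF ints B_bound lim] by auto
  qed
  have z_fix: "z t = \<Phi> z t" if t: "t \<in> {s..e}" for t
  proof -
    have "(\<lambda>n. \<Phi> (v n) t) \<longlonglongrightarrow> \<Phi> z t"
      using H_lim[OF t] H_lim[of e] \<open>s < e\<close> \<open>K > 0\<close>
      unfolding \<Phi>_def periodic_resolvent_def H_def
      by (auto intro!: tendsto_intros)
    moreover have "(\<lambda>n. \<Phi> (v n) t) \<longlonglongrightarrow> z t"
      using LIMSEQ_Suc[OF v_lim[OF t]] by (simp add: v_Suc)
    ultimately show ?thesis
      by (rule LIMSEQ_unique[symmetric])
  qed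
  \<comment> \<open>Regularity of the limit: it agrees with \<open>\<Phi> z\<close>, which is continuous because it depends on
    \<open>t\<close> only through an exponential and an indefinite integral.\<close>
  have "H z integrable_on {s..e}"
    using H_lim[of e] \<open>s < e\<close> by simp
  then have "continuous_on {s..e} (\<lambda>t. integral {s..t} (H z))"
    by (rule indefinite_integral_continuous_1)
  then have "continuous_on {s..e} (\<Phi> z)"
    unfolding \<Phi>_def periodic_resolvent_def [abs_def] H_def [abs_def] by (intro continuous_intros)
  then have z_cont: "continuous_on {s..e} z"
    by (rule continuous_on_eq) (simp add: z_fix[symmetric])
  show thesis
  proof
    fix t assume t: "t \<in> {s..e}"
    have "(\<Phi> z has_real_derivative F t (z t)) (at t within {s..e})"
      using \<Phi>_deriv[OF z_cont t] z_fix[OF t] by (simp add: G_def)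
    then show "(z has_real_derivative F t (z t)) (at t within {s..e})"
      by (rule has_field_derivative_transform_within[OF _ zero_less_one t]) (simp add: z_fix)
    show "\<alpha> t \<le> z t \<and> z t \<le> \<beta> t"
      using z_between[OF t] .
  next
    show "z s = z e"
      using \<open>s < e\<close> by (simp add: z_fix \<Phi>_closed)
  qed
qed
section \<open>An upper solution from the positive average\<close>

text \<open>
  The points of the open interval with \<open>a < 0\<close> form an open null set, which is empty; the end
  points follow by continuity.
\<close>
lemma AE_positive_imp_nonneg:
  fixes a :: "real \<Rightarrow> real"
  assumes "s < e" and a: "continuous_on {s..e} a"
    and pos: "AE t in lebesgue. t \<in> {s..e} \<longrightarrow> a t > 0" and t: "t \<in> {s..e}"
  shows "0 \<le> a t"
proof -
  have cl: "closure {s<..<e} = {s..e}"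
    using \<open>s < e\<close> by simp
  have "closed {x \<in> {s..e}. 0 \<le> a x}"
    using a by (intro continuous_on_closed_Collect_le continuous_intros) auto
  moreover have "AE x \<in> {s<..<e} in lebesgue. x \<in> {x \<in> {s..e}. 0 \<le> a x}"
    using pos by eventually_elim auto
  ultimately have "x \<in> {x \<in> {s..e}. 0 \<le> a x}" if "x \<in> {s<..<e}" for x
    using mem_closed_if_AE_lebesgue_open[OF open_greaterThanLessThan] that by blast
  then show ?thesis
    using continuous_ge_on_closure[of "{s<..<e}" a t 0] a t by (auto simp: cl)
qed

text \<open>
  For \<open>\<epsilon> > 0\<close> the function \<open>q \<epsilon>\<close> lies almost everywhere between \<open>c - b\<^sup>2 / (4 * a)\<close> and \<open>c\<close>.
  The lower bound carries the positive average over to the regularisation; both together bound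
  \<open>\<bar>q \<epsilon>\<bar>\<close> by the integrable function \<open>\<bar>c\<bar> + b\<^sup>2 / (4 * a)\<close>, and its integral serves as the
  bound \<open>A\<close> for every \<open>\<epsilon>\<close>.
\<close>
lemma regularised_average:
  fixes a b c :: "real \<Rightarrow> real"
  defines "q \<equiv> (\<lambda>\<epsilon> t. c t - (b t)\<^sup>2 / (4 * (a t + \<epsilon>)))"
  assumes "s < e"
    and cont: "continuous_on {s..e} a" "continuous_on {s..e} b" "continuous_on {s..e} c"
    and pos: "AE t in lebesgue. t \<in> {s..e} \<longrightarrow> a t > 0"
    and int: "set_integrable lebesgue {s..e} (\<lambda>t. (b t)\<^sup>2 / a t)"
  obtains A where
    "\<And>\<epsilon>. 0 < \<epsilon> \<Longrightarrow> continuous_on {s..e} (q \<epsilon>)"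
    "\<And>\<epsilon>. 0 < \<epsilon> \<Longrightarrow> (LINT t:{s..e}|lebesgue. c t - (b t)\<^sup>2 / (4 * a t)) \<le> integral {s..e} (q \<epsilon>)"
    "\<And>\<epsilon> t. 0 < \<epsilon> \<Longrightarrow> t \<in> {s..e} \<Longrightarrow> \<bar>integral {s..t} (q \<epsilon>)\<bar> \<le> A"
proof -
  define h where "h t = \<bar>c t\<bar> + (b t)\<^sup>2 / (4 * a t)" for t
  have nonneg: "0 \<le> a t" if "t \<in> {s..e}" for t
    using AE_positive_imp_nonneg[OF \<open>s < e\<close> cont(1) pos that] .
  have int4: "set_integrable lebesgue {s..e} (\<lambda>t. (b t)\<^sup>2 / (4 * a t))"
    using set_integrable_mult_right[OF int, of "1/4"] by simp
  have p_int: "set_integrable lebesgue {s..e} (\<lambda>t. c t - (b t)\<^sup>2 / (4 * a t))"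
    by (intro set_integral_diff absolutely_integrable_continuous_real cont int4)
  have h_int: "set_integrable lebesgue {s..e} h"
    unfolding h_def [abs_def]
    by (intro set_integral_add absolutely_integrable_continuous_real continuous_intros cont int4)
  show thesis
  proof
    fix \<epsilon> :: real assume \<epsilon>: "0 < \<epsilon>"
    have "4 * (a t + \<epsilon>) \<noteq> 0" if "t \<in> {s..e}" for t
      using nonneg[OF that] \<epsilon> by simp
    then show q_cont: "continuous_on {s..e} (q \<epsilon>)"
      unfolding q_def by (intro continuous_intros cont) blast
    have q_int: "set_integrable lebesgue {s..e} (q \<epsilon>)"
      by (rule absolutely_integrable_continuous_real[OF q_cont])
    have le: "(b t)\<^sup>2 / (4 * (a t + \<epsilon>)) \<le> (b t)\<^sup>2 / (4 * a t)" if "a t > 0" for t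
      using that \<epsilon> by (intro divide_left_mono) auto
    have "AE t \<in> {s..e} in lebesgue. c t - (b t)\<^sup>2 / (4 * a t) \<le> q \<epsilon> t"
      using pos by eventually_elim (use le in \<open>auto simp: q_def\<close>)
    then show "(LINT t:{s..e}|lebesgue. c t - (b t)\<^sup>2 / (4 * a t)) \<le> integral {s..e} (q \<epsilon>)"
      using set_integral_mono_AE[OF p_int q_int] set_lebesgue_integral_eq_integral(2)[OF q_int] by simp
    fix t assume t: "t \<in> {s..e}"
    have abs_cont: "continuous_on {s..e} (\<lambda>r. \<bar>q \<epsilon> r\<bar>)"
      by (intro continuous_intros q_cont)
    have sub: "q \<epsilon> integrable_on {s..t}" "(\<lambda>r. \<bar>q \<epsilon> r\<bar>) integrable_on {s..t}"
      using q_cont abs_cont t by (auto intro!: integrable_continuous_real elim: continuous_on_subset)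
    have "\<bar>integral {s..t} (q \<epsilon>)\<bar> \<le> integral {s..t} (\<lambda>r. \<bar>q \<epsilon> r\<bar>)"
      using integral_norm_bound_integral[OF sub] by simp
    also have "\<dots> \<le> integral {s..e} (\<lambda>r. \<bar>q \<epsilon> r\<bar>)"
      using t sub abs_cont by (intro integral_subset_le) (auto intro: integrable_continuous_real)
    also have "\<dots> = (LINT r:{s..e}|lebesgue. \<bar>q \<epsilon> r\<bar>)"
      using set_lebesgue_integral_eq_integral(2)[OF absolutely_integrable_continuous_real[OF abs_cont]]
      by simp
    also have "\<dots> \<le> (LINT r:{s..e}|lebesgue. h r)"
    proof (rule set_integral_mono_AE[OF absolutely_integrable_continuous_real[OF abs_cont] h_int])
      show "AE r \<in> {s..e} in lebesgue. \<bar>q \<epsilon> r\<bar> \<le> h r"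
        using pos
      proof eventually_elim
        case (elim r)
        have "\<bar>q \<epsilon> r\<bar> \<le> \<bar>c r\<bar> + (b r)\<^sup>2 / (4 * (a r + \<epsilon>))" if "a r > 0"
          unfolding q_def using that \<epsilon> by (intro order_trans[OF abs_triangle_ineq4]) auto
        with elim le[of r] show ?case
          unfolding h_def by fastforce
      qed
    qed
    finally show "\<bar>integral {s..t} (q \<epsilon>)\<bar> \<le> (LINT r:{s..e}|lebesgue. h r)" .
  qed
qed

lemma quadratic_lower_bound:
  fixes A B C x :: real
  assumes "A > 0"
  shows "C - B\<^sup>2 / (4 * A) \<le> A * x\<^sup>2 - B * x + C"
proof -
  have "A * x\<^sup>2 - B * x + B\<^sup>2 / (4 * A) = (2 * A * x - B)\<^sup>2 / (4 * A)"
    using assms by (simp add: field_simps power2_eq_square)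
  also have "\<dots> \<ge> 0"
    using assms by simp
  finally show ?thesis
    by linarith
qed

text \<open>
  The constants are chosen in the order \<open>A\<close>, \<open>C\<close>, \<open>N\<close>, \<open>\<epsilon>\<close>.  The bound \<open>A\<close> on the primitives
  holds for all \<open>\<epsilon>\<close>, so \<open>C\<close> can make \<open>\<eta> / 2 * \<beta>\<close> exceed \<open>d\<close>, and \<open>N\<close> can bound \<open>\<beta>\<close> from above,
  before \<open>\<epsilon>\<close> is taken so small that \<open>\<epsilon> * \<beta>\<^sup>3 \<le> \<eta> / 2 * \<beta>\<close>.
\<close>
lemma upper_solution_exists:
  fixes a b c d :: "real \<Rightarrow> real"
  assumes "s < e"
    and cont: "continuous_on {s..e} a" "continuous_on {s..e} b"
      "continuous_on {s..e} c" "continuous_on {s..e} d"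
    and pos: "AE t in lebesgue. t \<in> {s..e} \<longrightarrow> a t > 0"
    and int: "set_integrable lebesgue {s..e} (\<lambda>t. (b t)\<^sup>2 / a t)"
    and avg: "(LINT t:{s..e}|lebesgue. c t - (b t)\<^sup>2 / (4 * a t)) > 0"
  obtains \<beta> \<beta>' :: "real \<Rightarrow> real" where
    "\<And>t. t \<in> {s..e} \<Longrightarrow> (\<beta> has_real_derivative \<beta>' t) (at t within {s..e})"
    "\<And>t. t \<in> {s..e} \<Longrightarrow> d t - c t * \<beta> t + b t * \<beta> t ^ 2 - a t * \<beta> t ^ 3 \<le> \<beta>' t"
    "\<And>t. t \<in> {s..e} \<Longrightarrow> 0 < \<beta> t" "\<beta> e \<le> \<beta> s"
proof -
  define \<sigma> where "\<sigma> = (LINT t:{s..e}|lebesgue. c t - (b t)\<^sup>2 / (4 * a t))"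
  define \<eta> where "\<eta> = \<sigma> / (e - s)"
  define q where "q \<epsilon> t = c t - (b t)\<^sup>2 / (4 * (a t + \<epsilon>))" for \<epsilon> t
  have "\<sigma> > 0" "\<eta> > 0"
    using avg \<open>s < e\<close> by (simp_all add: \<sigma>_def \<eta>_def)
  obtain A where q_cont: "\<And>\<epsilon>. 0 < \<epsilon> \<Longrightarrow> continuous_on {s..e} (q \<epsilon>)"
    and q_avg: "\<And>\<epsilon>. 0 < \<epsilon> \<Longrightarrow> \<sigma> \<le> integral {s..e} (q \<epsilon>)"
    and q_bound: "\<And>\<epsilon> t. 0 < \<epsilon> \<Longrightarrow> t \<in> {s..e} \<Longrightarrow> \<bar>integral {s..t} (q \<epsilon>)\<bar> \<le> A"
    unfolding q_def [abs_def] \<sigma>_def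
    by (rule regularised_average[OF \<open>s < e\<close> cont(1-3) pos int]) blast
  obtain t1 where t1: "\<forall>t\<in>{s..e}. d t \<le> d t1"
    using continuous_attains_sup[of "{s..e}" d] cont(4) \<open>s < e\<close> by auto
  define D where "D = \<bar>d t1\<bar> + 1"
  have "D > 0"
    by (simp add: D_def)
  have D: "d t \<le> D" if "t \<in> {s..e}" for t
    using bspec[OF t1 that] unfolding D_def by linarith
  define C where "C = 2 * D * exp A / \<eta>"
  define N where "N = C * exp (\<sigma> + A)"
  define \<epsilon> where "\<epsilon> = \<eta> / (2 * N\<^sup>2)"
  have "C > 0" "N > 0" "\<epsilon> > 0"
    using \<open>D > 0\<close> \<open>\<eta> > 0\<close> by (simp_all add: C_def N_def \<epsilon>_def)
  define Q where "Q t = integral {s..t} (q \<epsilon>)" for t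
  define \<beta> where "\<beta> t = C * exp (\<eta> * (t - s) - Q t)" for t
  show thesis
  proof
    fix t assume t: "t \<in> {s..e}"
    have "(Q has_real_derivative q \<epsilon> t) (at t within {s..e})"
      unfolding Q_def [abs_def] by (rule integral_has_real_derivative[OF q_cont[OF \<open>\<epsilon> > 0\<close>] t])
    then show "(\<beta> has_real_derivative (\<eta> - q \<epsilon> t) * \<beta> t) (at t within {s..e})"
      unfolding \<beta>_def [abs_def] by (auto intro!: derivative_eq_intros)
    show "0 < \<beta> t"
      using \<open>C > 0\<close> by (simp add: \<beta>_def)
    have Q: "\<bar>Q t\<bar> \<le> A"
      using q_bound[OF \<open>\<epsilon> > 0\<close> t] by (simp add: Q_def)
    have len: "0 \<le> \<eta> * (t - s)" "\<eta> * (t - s) \<le> \<sigma>"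
    proof -
      show "0 \<le> \<eta> * (t - s)"
        using t \<open>\<eta> > 0\<close> by simp
      have "\<eta> * (t - s) \<le> \<eta> * (e - s)"
        using t \<open>\<eta> > 0\<close> by simp
      then show "\<eta> * (t - s) \<le> \<sigma>"
        using \<open>s < e\<close> by (simp add: \<eta>_def)
    qed
    have "C * exp (- A) \<le> \<beta> t"
      unfolding \<beta>_def using Q len \<open>C > 0\<close> by simp
    moreover have "C * exp (- A) = 2 * D / \<eta>"
      by (simp add: C_def exp_minus)
    ultimately have low: "D \<le> \<eta> / 2 * \<beta> t"
      using \<open>\<eta> > 0\<close> by (simp add: field_simps)
    have "\<beta> t \<le> N"
      unfolding \<beta>_def N_def using Q len \<open>C > 0\<close> by simp
    then have "(\<beta> t)\<^sup>2 \<le> N\<^sup>2"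
      using \<open>0 < \<beta> t\<close> by (intro power_mono) auto
    then have "\<epsilon> * (\<beta> t)\<^sup>2 \<le> \<epsilon> * N\<^sup>2"
      using \<open>\<epsilon> > 0\<close> by simp
    also have "\<epsilon> * N\<^sup>2 = \<eta> / 2"
      using \<open>N > 0\<close> by (simp add: \<epsilon>_def)
    finally have high: "\<epsilon> * (\<beta> t)\<^sup>2 * \<beta> t \<le> \<eta> / 2 * \<beta> t"
      using \<open>0 < \<beta> t\<close> by (intro mult_right_mono) auto
    have "a t + \<epsilon> > 0"
      using AE_positive_imp_nonneg[OF \<open>s < e\<close> cont(1) pos t] \<open>\<epsilon> > 0\<close> by simp
    then have "q \<epsilon> t * \<beta> t \<le> ((a t + \<epsilon>) * (\<beta> t)\<^sup>2 - b t * \<beta> t + c t) * \<beta> t"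
      unfolding q_def using \<open>0 < \<beta> t\<close> by (intro mult_right_mono quadratic_lower_bound) auto
    then show "d t - c t * \<beta> t + b t * \<beta> t ^ 2 - a t * \<beta> t ^ 3 \<le> (\<eta> - q \<epsilon> t) * \<beta> t"
      using low high D[OF t] by (simp add: algebra_simps power2_eq_square power3_eq_cube)
  next
    have "\<eta> * (e - s) = \<sigma>"
      using \<open>s < e\<close> by (simp add: \<eta>_def)
    then show "\<beta> e \<le> \<beta> s"
      using q_avg[OF \<open>\<epsilon> > 0\<close>] \<open>C > 0\<close> by (simp add: \<beta>_def Q_def)
  qed
qed

section \<open>Closed solutions of the cubic equation\<close>

lemma continuous_on_Icc_abs_bound:
  fixes f :: "real \<Rightarrow> real"
  assumes "continuous_on {s..e} f"
  obtains M where "0 \<le> M" "\<And>t. t \<in> {s..e} \<Longrightarrow> \<bar>f t\<bar> \<le> M"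
proof -
  have "bounded (f ` {s..e})"
    using assms by (intro compact_imp_bounded compact_continuous_image) auto
  then obtain M where "M > 0" "\<forall>x\<in>f ` {s..e}. norm x \<le> M"
    unfolding bounded_pos by blast
  then show thesis
    by (intro that[of M]) auto
qed

text \<open>
  The difference of the two sides is \<open>y - x\<close> times
  \<open>K - c + b * (x + y) - a * (x\<^sup>2 + x * y + y\<^sup>2)\<close>, and \<open>K\<close> exceeds the other terms of that factor
  on \<open>[0, M]\<close>.
\<close>
lemma cubic_plus_linear_mono:
  fixes a b c d x y M A B C :: real
  assumes "0 \<le> x" "x \<le> y" "y \<le> M" "\<bar>a\<bar> \<le> A" "\<bar>b\<bar> \<le> B" "\<bar>c\<bar> \<le> C"
  defines "K \<equiv> 1 + C + 2 * B * M + 3 * A * M\<^sup>2"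
  shows "d - c * x + b * x ^ 2 - a * x ^ 3 + K * x \<le> d - c * y + b * y ^ 2 - a * y ^ 3 + K * y"
proof -
  have "\<bar>b * (x + y)\<bar> \<le> B * (2 * M)"
    unfolding abs_mult using assms by (intro mult_mono) auto
  moreover have "x\<^sup>2 + x * y + y\<^sup>2 \<le> 3 * M\<^sup>2"
  proof -
    have "x\<^sup>2 \<le> M\<^sup>2" "y\<^sup>2 \<le> M\<^sup>2"
      using assms by (auto intro: power_mono)
    moreover have "x * y \<le> M * M"
      using assms by (intro mult_mono) auto
    ultimately show ?thesis
      by (simp add: power2_eq_square)
  qed
  then have "\<bar>a * (x\<^sup>2 + x * y + y\<^sup>2)\<bar> \<le> A * (3 * M\<^sup>2)"
    unfolding abs_mult using assms by (intro mult_mono) auto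
  ultimately have "0 \<le> K - c + b * (x + y) - a * (x\<^sup>2 + x * y + y\<^sup>2)"
    using assms(6) unfolding K_def by linarith
  then have "0 \<le> (y - x) * (K - c + b * (x + y) - a * (x\<^sup>2 + x * y + y\<^sup>2))"
    using \<open>x \<le> y\<close> by simp
  then show ?thesis
    by (simp add: algebra_simps power2_eq_square power3_eq_cube)
qed

theorem theorem5p2:
  fixes a b c d :: "real \<Rightarrow> real" and t\<^sub>0 T :: real
  assumes "t\<^sub>0 < T"
    and "continuous_on {t\<^sub>0..T} a" "continuous_on {t\<^sub>0..T} b"
    and "continuous_on {t\<^sub>0..T} c" "continuous_on {t\<^sub>0..T} d"
    and "AE t in lebesgue. t \<in> {t\<^sub>0..T} \<longrightarrow> a t > 0"
    and "set_integrable lebesgue {t\<^sub>0..T} (\<lambda>t. (b t)\<^sup>2 / a t)"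
    and "(LINT t:{t\<^sub>0..T}|lebesgue. c t - (b t)\<^sup>2 / (4 * a t)) > 0"
    and "\<forall>t\<in>{t\<^sub>0..T}. d t \<ge> 0"
  shows "\<exists>y. abel_closed_solution_on a b c d t\<^sub>0 T y \<and> (\<forall>t\<in>{t\<^sub>0..T}. y t \<le> 0)"
proof -
  define F where "F t x = d t - c t * x + b t * x ^ 2 - a t * x ^ 3" for t x
  obtain \<beta> \<beta>' where \<beta>: "\<And>t. t \<in> {t\<^sub>0..T} \<Longrightarrow> (\<beta> has_real_derivative \<beta>' t) (at t within {t\<^sub>0..T})"
    and upper: "\<And>t. t \<in> {t\<^sub>0..T} \<Longrightarrow> F t (\<beta> t) \<le> \<beta>' t"
    and \<beta>_pos: "\<And>t. t \<in> {t\<^sub>0..T} \<Longrightarrow> 0 < \<beta> t" and \<beta>_ends: "\<beta> T \<le> \<beta> t\<^sub>0"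
    unfolding F_def by (rule upper_solution_exists[OF assms(1-8)]) blast
  have \<beta>_cont: "continuous_on {t\<^sub>0..T} \<beta>"
    by (rule DERIV_continuous_on) (erule \<beta>)
  obtain A where A: "0 \<le> A" "\<And>t. t \<in> {t\<^sub>0..T} \<Longrightarrow> \<bar>a t\<bar> \<le> A"
    by (rule continuous_on_Icc_abs_bound[OF assms(2)]) blast
  obtain B where B: "0 \<le> B" "\<And>t. t \<in> {t\<^sub>0..T} \<Longrightarrow> \<bar>b t\<bar> \<le> B"
    by (rule continuous_on_Icc_abs_bound[OF assms(3)]) blast
  obtain C where C: "0 \<le> C" "\<And>t. t \<in> {t\<^sub>0..T} \<Longrightarrow> \<bar>c t\<bar> \<le> C"
    by (rule continuous_on_Icc_abs_bound[OF assms(4)]) blast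
  obtain M where M: "0 \<le> M" "\<And>t. t \<in> {t\<^sub>0..T} \<Longrightarrow> \<bar>\<beta> t\<bar> \<le> M"
    by (rule continuous_on_Icc_abs_bound[OF \<beta>_cont]) blast
  define K where "K = 1 + C + 2 * B * M + 3 * A * M\<^sup>2"
  have "K > 0"
    using A(1) B(1) C(1) M(1) unfolding K_def by (intro add_pos_nonneg) auto
  have F_cont: "continuous_on ({t\<^sub>0..T} \<times> UNIV) (\<lambda>(t, x). F t x)"
  proof -
    have coeff: "continuous_on ({t\<^sub>0..T} \<times> UNIV) (\<lambda>p. f (fst p))"
      if "continuous_on {t\<^sub>0..T} f" for f :: "real \<Rightarrow> real"
      by (rule continuous_on_compose2[OF that]) (auto intro: continuous_intros)
    show ?thesis
      unfolding F_def case_prod_unfold by (intro continuous_intros coeff assms)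
  qed
  have slope: "F t x + K * x \<le> F t y + K * y"
    if t: "t \<in> {t\<^sub>0..T}" and "0 \<le> x" "x \<le> y" "y \<le> \<beta> t" for t x y
  proof -
    have "y \<le> M"
      using M(2)[OF t] that by linarith
    then show ?thesis
      unfolding F_def K_def by (intro cubic_plus_linear_mono A B C that)
  qed
  obtain z where z: "\<And>t. t \<in> {t\<^sub>0..T} \<Longrightarrow> (z has_real_derivative F t (z t)) (at t within {t\<^sub>0..T})"
    and z_closed: "z t\<^sub>0 = z T"
    and z_between: "\<And>t. t \<in> {t\<^sub>0..T} \<Longrightarrow> 0 \<le> z t \<and> z t \<le> \<beta> t"
  proof (rule closed_solution_between_lower_and_upper[OF assms(1) \<open>K > 0\<close> F_cont slope _ \<beta> _ _ upper \<beta>_ends])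
    show "((\<lambda>_. 0) has_real_derivative (\<lambda>_. 0) t) (at t within {t\<^sub>0..T})" for t :: real
      by simp
    show "0 \<le> F t 0" if "t \<in> {t\<^sub>0..T}" for t
      using assms(9) that by (simp add: F_def)
    show "0 \<le> \<beta> t" if "t \<in> {t\<^sub>0..T}" for t
      using \<beta>_pos[OF that] by simp
  qed auto
  have "abel_closed_solution_on a b c d t\<^sub>0 T (\<lambda>t. - z t)"
    unfolding abel_closed_solution_on_def abel_solution_on_def
  proof (intro conjI ballI exI)
    fix t assume t: "t \<in> {t\<^sub>0..T}"
    show "((\<lambda>t. - z t) has_real_derivative - F t (z t)) (at t within {t\<^sub>0..T})"
      by (rule DERIV_minus[OF z[OF t]])
    show "- F t (z t) + a t * (- z t) ^ 3 + b t * (- z t) ^ 2 + c t * (- z t) + d t = 0"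
      by (simp add: F_def)
  qed (simp add: z_closed)
  then show ?thesis
    using z_between by (intro exI[of _ "\<lambda>t. - z t"]) auto
qed

end
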